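(* Let $s\ge 2$ be an integer and let $x\in[0,1]$. If the frequencies $\nu_0(x),\nu_1(x),\dots,\nu_{s-1}(x)$ of all digits in the $s$-nary representation of $x$ exist, then the asymptotic mean value of digits $r(x)$ exists and $$r(x)=\nu_1(x)+2\nu_2(x)+\dots+(s-1)\nu_{s-1}(x).$$
   Context: Every $x\in[0,1]$ has an $s$-nary representation $x=\sum_{k\ge 1}\alpha_k s^{-k}$ with $\alpha_k\in\{0,1,\dots,s-1\}$. If $x$ has two such representations, the one ending in zeros (period $(0)$) is used; the number $1$ has only the representation with all digits equal to $s-1$. Thus the $k$-th digit $\alpha_k(x)$ is well defined. For $i\in\{0,\dots,s-1\}$ put $N_i(x,k)=\#\{j\le k:\alpha_j(x)=i\}$. The frequency of digit $i$ in $x$ is $\nu_i(x)=\lim_{k\to\infty}N_i(x,k)/k$, if this limit exists. The asymptotic mean value of the digits of $x$ is $r(x)=\lim_{n\to\infty}\frac1n\sum_{i=1}^n\alpha_i(x)$, if this limit exists. *)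

theory Defs
  imports "HOL-Analysis.Analysis"
begin

(* A digit sequence is 0-indexed here: "a k" is the digit at s^-(k+1). This avoids a junk value
   at index 0, which would spoil uniqueness of the sequence. *)
definition nary_rep :: "nat \<Rightarrow> real \<Rightarrow> (nat \<Rightarrow> nat) \<Rightarrow> bool" where
  "nary_rep s x a \<longleftrightarrow>
     (\<forall>k. a k < s) \<and> (\<lambda>k. real (a k) / real s ^ Suc k) sums x"

(* If x has more than one representation, the chosen one has period (0). For x = 1 the
   representation is unique (all digits s - 1). *)
definition nary_digits :: "nat \<Rightarrow> real \<Rightarrow> nat \<Rightarrow> nat" where
  "nary_digits s x =
     (THE a. nary_rep s x a \<and>
        ((\<exists>b. nary_rep s x b \<and> b \<noteq> a) \<longrightarrow> (\<exists>m. \<forall>k\<ge>m. a k = 0)))"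

(* Digits are numbered from 1; the value at k = 0 is meaningless. *)
definition nary_digit :: "nat \<Rightarrow> real \<Rightarrow> nat \<Rightarrow> nat" where
  "nary_digit s x k = nary_digits s x (k - 1)"

definition digit_count :: "nat \<Rightarrow> nat \<Rightarrow> real \<Rightarrow> nat \<Rightarrow> nat" where
  "digit_count s i x k = card {j \<in> {1..k}. nary_digit s x j = i}"

definition rel_digit_count :: "nat \<Rightarrow> nat \<Rightarrow> real \<Rightarrow> nat \<Rightarrow> real" where
  "rel_digit_count s i x k = real (digit_count s i x k) / real k"

(* Meaningful only if "convergent (rel_digit_count s i x)". *)
definition digit_freq :: "nat \<Rightarrow> nat \<Rightarrow> real \<Rightarrow> real" where
  "digit_freq s i x = lim (rel_digit_count s i x)"

definition digit_mean :: "nat \<Rightarrow> real \<Rightarrow> nat \<Rightarrow> real" where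
  "digit_mean s x n = (1 / real n) * (\<Sum>i=1..n. real (nary_digit s x i))"

(* Meaningful only if "convergent (digit_mean s x)". *)
definition asymp_digit_mean :: "nat \<Rightarrow> real \<Rightarrow> real" where
  "asymp_digit_mean s x = lim (digit_mean s x)"

end

theory Submission
  imports Defs
begin

text \<open>The digit sum splits as \<open>\<alpha>\<^sub>1 + \<dots> + \<alpha>\<^sub>n = \<Sum>i<s. i * N\<^sub>i(x,n)\<close>; divide by \<open>n\<close> and pass to
  the limit. This needs every digit to be below \<open>s\<close>, hence that the definite description
  in \<^const>\<open>nary_digits\<close> denotes: two distinct representations of the same number, the first smaller
  than the second at their first difference, continue with digits \<open>s - 1\<close> and \<open>0\<close> respectively.\<close>

text \<open>Geometric series with ratio \<open>1 / s\<close>. It bounds what the digits after index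
  \<open>m\<close> can contribute: at most one unit of the digit at index \<open>m\<close>.\<close>

lemma geometric_tail_sums:
  assumes "s \<ge> (2::nat)"
  shows "(\<lambda>k. real (s - 1) / real s ^ Suc (k + Suc m)) sums (1 / real s ^ Suc m)"
proof -
  have "(\<lambda>k. (real (s - 1) / real s ^ Suc (Suc m)) * (1 / real s) ^ k)
          sums ((real (s - 1) / real s ^ Suc (Suc m)) * (1 / (1 - 1 / real s)))"
    using assms by (intro sums_mult geometric_sums) auto
  moreover have "(real (s - 1) / real s ^ Suc (Suc m)) * (1 / (1 - 1 / real s)) = 1 / real s ^ Suc m"
    using assms by (simp add: field_simps of_nat_diff)
  moreover have "(real (s - 1) / real s ^ Suc (Suc m)) * (1 / real s) ^ k
          = real (s - 1) / real s ^ Suc (k + Suc m)" for k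
    by (simp add: power_add power_divide field_simps)
  ultimately show ?thesis by simp
qed

text \<open>The later digits of \<open>a\<close> must recover the deficit at \<open>m\<close>, which
  is at least one unit there. That is also the most they can gain over those of \<open>b\<close>, so
  every later digit has to be extremal.\<close>

lemma nary_rep_first_difference:
  assumes s: "s \<ge> 2" and a: "nary_rep s x a" and b: "nary_rep s x b"
    and eq: "\<And>k. k < m \<Longrightarrow> a k = b k" and less: "a m < b m" and "k > m"
  shows "a k = s - 1 \<and> b k = 0"
proof -
  define d where "d = (\<lambda>k. real (a k) / real s ^ Suc k - real (b k) / real s ^ Suc k)"
  \<comment> \<open>The slack at each later index: the greatest possible gain of \<open>a\<close>
    over \<open>b\<close> minus the actual one.\<close>
  define g where "g = (\<lambda>j. real (s - 1) / real s ^ Suc (j + Suc m) - d (j + Suc m))"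
  have g_eq: "g j = (real (s - 1) - real (a (j + Suc m)) + real (b (j + Suc m))) / real s ^ Suc (j + Suc m)" for j
    by (simp add: g_def d_def diff_divide_distrib add_divide_distrib)
  have a_le: "real (a j) \<le> real (s - 1)" for j
  proof -
    have "a j < s" using a unfolding nary_rep_def by blast
    then show ?thesis by linarith
  qed
  have nonneg: "g j \<ge> 0" for j
    using a_le[of "j + Suc m"] by (simp add: g_eq)
  have "d sums (x - x)"
    using a b unfolding nary_rep_def d_def by (intro sums_diff) auto
  then have "(\<lambda>j. d (j + Suc m)) sums (x - x - (\<Sum>j<Suc m. d j))"
    by (subst sums_iff_shift) simp
  moreover have "(\<Sum>j<Suc m. d j) = d m"
    by (simp add: d_def eq)
  ultimately have "g sums (1 / real s ^ Suc m - (- d m))"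
    using sums_diff[OF geometric_tail_sums[OF s]] unfolding g_def by fastforce
  \<comment> \<open>The total slack is nonpositive, since \<open>a m + 1 \<le> b m\<close> for
    integers; as its terms are nonnegative, all of them vanish.\<close>
  moreover have "1 / real s ^ Suc m + d m \<le> 0"
  proof -
    have "1 / real s ^ Suc m + d m = (1 + real (a m) - real (b m)) / real s ^ Suc m"
      by (simp add: d_def diff_divide_distrib add_divide_distrib)
    also have "\<dots> \<le> 0"
      using less by (intro divide_nonpos_nonneg) auto
    finally show ?thesis .
  qed
  ultimately have summable: "summable g" and "suminf g \<le> 0"
    by (auto simp: sums_iff)
  then have "suminf g = 0"
    using suminf_nonneg[of g] nonneg by (meson antisym)
  then have "g (k - Suc m) = 0"
    using suminf_eq_zero_iff[OF summable] nonneg by blast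
  then have "real (s - 1) - real (a k) + real (b k) = 0"
    using \<open>k > m\<close> s by (simp add: g_eq)
  \<comment> \<open>Both \<open>s - 1 - a k\<close> and \<open>b k\<close> are nonnegative, so each
    is zero.\<close>
  then show ?thesis
    using a_le[of k] by (auto simp del: of_nat_diff)
qed

lemma first_difference:
  fixes a b :: "nat \<Rightarrow> 'a"
  assumes "a \<noteq> b"
  obtains m where "\<And>k. k < m \<Longrightarrow> a k = b k" "a m \<noteq> b m"
proof -
  have "\<exists>m. a m \<noteq> b m" using assms by auto
  then obtain m where "a m \<noteq> b m" "\<forall>k<m. \<not> a k \<noteq> b k"
    unfolding exists_least_iff[of "\<lambda>m. a m \<noteq> b m"] by blast
  then show ?thesis using that by blast
qed

text \<open>For \<open>x < 1\<close> the digits are read off from the integers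
  \<open>\<lfloor>s ^ n * x\<rfloor>\<close>. At \<open>x = 1\<close> this recipe would yield only
  zeros, so the constant sequence \<open>s - 1\<close> is used instead.\<close>

lemma nary_rep_ex:
  assumes s: "s \<ge> 2" and x: "0 \<le> x" "x \<le> 1"
  shows "\<exists>a. nary_rep s x a"
proof (cases "x = 1")
  case True
  have "(\<lambda>k. real (s - 1) / real s ^ Suc k) sums 1"
  proof -
    have "(\<lambda>k. real (s - 1) / real s ^ Suc (Suc k)) sums (1 / real s)"
      using geometric_tail_sums[OF s, of 0] by simp
    then have "(\<lambda>k. real (s - 1) / real s ^ Suc k) sums (1 / real s + real (s - 1) / real s ^ Suc 0)"
      by (rule sums_Suc)
    moreover have "1 / real s + real (s - 1) / real s ^ Suc 0 = 1"
      using s by (simp add: field_simps of_nat_diff)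
    ultimately show ?thesis by simp
  qed
  then show ?thesis
    using s True by (auto simp: nary_rep_def intro!: exI[of _ "\<lambda>_. s - 1"])
next
  case False
  \<comment> \<open>For \<open>x < 1\<close>, \<open>f n\<close> is the integer whose
    base-\<open>s\<close> numeral consists of the first \<open>n\<close> digits.\<close>
  define f where "f = (\<lambda>n. \<lfloor>real s ^ n * x\<rfloor>)"
  define a where "a = (\<lambda>k. nat (f (Suc k) mod int s))"
  have a_real: "real (a k) = of_int (f (Suc k) mod int s)" for k
    using s by (simp add: a_def)
  have f_Suc: "f (Suc n) = int s * f n + f (Suc n) mod int s" for n
  proof -
    have "f n = \<lfloor>real s ^ Suc n * x / of_int (int s)\<rfloor>"
      using s by (simp add: f_def)
    also have "\<dots> = f (Suc n) div int s"
      unfolding f_def by (rule floor_divide_real_eq_div) simp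
    finally show ?thesis by simp
  qed
  have partial: "(\<Sum>k<n. real (a k) / real s ^ Suc k) = of_int (f n) / real s ^ n" for n
  proof (induction n)
    case 0
    \<comment> \<open>Here \<open>x < 1\<close> is essential: it gives \<open>f 0 = 0\<close>, so
      there is no integer part.\<close>
    show ?case using x False by (simp add: f_def floor_eq_iff)
  next
    case (Suc n)
    have "of_int (f (Suc n)) = real s * of_int (f n) + real (a n)"
      unfolding a_real using arg_cong[OF f_Suc[of n], of real_of_int] by simp
    then show ?case
      using Suc s by (simp add: field_simps)
  qed
  \<comment> \<open>Rounding down loses less than 1, hence less than \<open>1 / s ^ n\<close> after
    rescaling.\<close>
  have "(\<lambda>n. of_int (f n) / real s ^ n) \<longlonglongrightarrow> x"
  proof (rule tendsto_sandwich)
    show "\<forall>\<^sub>F n in sequentially. x - (1 / real s) ^ n \<le> of_int (f n) / real s ^ n"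
    proof (intro always_eventually allI)
      fix n
      have "(real s ^ n * x - 1) / real s ^ n \<le> of_int (f n) / real s ^ n"
        unfolding f_def by (intro divide_right_mono) (linarith, simp)
      then show "x - (1 / real s) ^ n \<le> of_int (f n) / real s ^ n"
        using s by (simp add: power_one_over diff_divide_distrib inverse_eq_divide)
    qed
    show "\<forall>\<^sub>F n in sequentially. of_int (f n) / real s ^ n \<le> x"
      using s by (intro always_eventually allI) (simp add: f_def field_simps)
    have "(\<lambda>n. x - (1 / real s) ^ n) \<longlonglongrightarrow> x - 0"
      using s by (intro tendsto_diff tendsto_const LIMSEQ_power_zero) auto
    then show "(\<lambda>n. x - (1 / real s) ^ n) \<longlonglongrightarrow> x" by simp
  qed auto
  then have "(\<lambda>k. real (a k) / real s ^ Suc k) sums x"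
    unfolding sums_def partial .
  moreover have "a k < s" for k
    using s by (simp add: a_def nat_less_iff)
  ultimately show ?thesis by (auto simp: nary_rep_def)
qed

text \<open>Of two distinct representations, the one with the larger digit at the first difference
  ends in zeros and the other does not, so the condition in \<open>nary_digits\<close> selects
  exactly one. If the representation is unique, the condition on zeros is vacuous.\<close>

lemma nary_digits_rep:
  assumes s: "s \<ge> 2" and x: "0 \<le> x" "x \<le> 1"
  shows "nary_rep s x (nary_digits s x)"
proof -
  define P where "P = (\<lambda>a. nary_rep s x a \<and>
        ((\<exists>b. nary_rep s x b \<and> b \<noteq> a) \<longrightarrow> (\<exists>m. \<forall>k\<ge>m. a k = 0)))"
  have later_zero: "\<forall>k\<ge>Suc m. b k = 0"
    and later_nonzero: "\<not> (\<exists>n. \<forall>k\<ge>n. a k = 0)"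
    if "nary_rep s x a" "nary_rep s x b" "\<And>k. k < m \<Longrightarrow> a k = b k" "a m < b m" for a b m
  proof -
    have *: "a k = s - 1 \<and> b k = 0" if "k > m" for k
      using nary_rep_first_difference[OF s] \<open>nary_rep s x a\<close> \<open>nary_rep s x b\<close>
        \<open>\<And>k. k < m \<Longrightarrow> a k = b k\<close> \<open>a m < b m\<close> that by blast
    then show "\<forall>k\<ge>Suc m. b k = 0" by auto
    show "\<not> (\<exists>n. \<forall>k\<ge>n. a k = 0)"
    proof
      assume "\<exists>n. \<forall>k\<ge>n. a k = 0"
      then obtain n where "\<forall>k\<ge>n. a k = 0" ..
      \<comment> \<open>This index lies beyond both \<open>n\<close> and \<open>m\<close>, so the
        digit would be 0 and also \<open>s - 1 \<ge> 1\<close>.\<close>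
      then have "a (n + Suc m) = 0" by simp
      then show False using *[of "n + Suc m"] s by simp
    qed
  qed
  have "\<exists>a. P a"
  proof (cases "\<exists>a b. nary_rep s x a \<and> nary_rep s x b \<and> a \<noteq> b")
    case True
    then obtain a b where ab: "nary_rep s x a" "nary_rep s x b" "a \<noteq> b" by blast
    from \<open>a \<noteq> b\<close> obtain m where m: "\<And>k. k < m \<Longrightarrow> a k = b k" "a m \<noteq> b m"
      by (rule first_difference) blast
    consider "a m < b m" | "b m < a m" using m(2) by linarith
    then show ?thesis
    proof cases
      case 1
      then have "P b" unfolding P_def using later_zero ab m(1) by blast
      then show ?thesis by blast
    next
      case 2
      then have "P a" unfolding P_def using later_zero[OF ab(2,1)] ab m(1)[symmetric] 2 by blast
      then show ?thesis by blast
    qed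
  next
    case False
    then show ?thesis using nary_rep_ex[OF s x] unfolding P_def by blast
  qed
  moreover have "a = b" if Pa: "P a" and Pb: "P b" for a b
  proof (rule ccontr)
    assume "a \<noteq> b"
    have reps: "nary_rep s x a" "nary_rep s x b" using Pa Pb unfolding P_def by auto
    \<comment> \<open>Each of \<open>a\<close> and \<open>b\<close> is a competing representation
      for the other, which triggers the implication in \<open>P\<close>.\<close>
    have zeros: "\<exists>n. \<forall>k\<ge>n. a k = 0" "\<exists>n. \<forall>k\<ge>n. b k = 0"
      using Pa Pb \<open>a \<noteq> b\<close> unfolding P_def by metis+
    from \<open>a \<noteq> b\<close> obtain m where m: "\<And>k. k < m \<Longrightarrow> a k = b k" "a m \<noteq> b m"
      by (rule first_difference) blast
    then consider "a m < b m" | "b m < a m" by linarith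
    then show False
    proof cases
      case 1
      then show False using later_nonzero[OF reps m(1)] zeros(1) by blast
    next
      case 2
      then show False using later_nonzero[OF reps(2,1) m(1)[symmetric]] zeros(2) by blast
    qed
  qed
  ultimately have "\<exists>!a. P a"
    by blast
  then have "P (The P)"
    by (rule theI')
  then show ?thesis
    unfolding P_def nary_digits_def by (rule conjunct1)
qed

text \<open>Positions are grouped by their digit. The case \<open>n = 0\<close> is covered because
  division by zero gives 0 on both sides, so the two sides agree as functions of
  \<open>n\<close>.\<close>

lemma digit_mean_eq_sum_rel_digit_count:
  assumes s: "s \<ge> 2" and x: "0 \<le> x" "x \<le> 1"
  shows "digit_mean s x n = (\<Sum>i=1..s-1. real i * rel_digit_count s i x n)"
proof -
  have less: "nary_digit s x j < s" for j
    using nary_digits_rep[OF s x] unfolding nary_rep_def nary_digit_def by blast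
  have "(\<Sum>j=1..n. real (nary_digit s x j))
      = (\<Sum>i<s. \<Sum>j\<in>{j\<in>{1..n}. nary_digit s x j = i}. real (nary_digit s x j))"
    using less by (intro sum.group[symmetric]) auto
  also have "\<dots> = (\<Sum>i<s. real i * real (digit_count s i x n))"
    unfolding digit_count_def by (intro sum.cong) (auto simp: mult.commute)
  \<comment> \<open>The digit 0 contributes nothing to the sum.\<close>
  also have "\<dots> = (\<Sum>i=1..s-1. real i * real (digit_count s i x n))"
    by (intro sum.mono_neutral_right) auto
  finally show ?thesis
    by (simp add: digit_mean_def rel_digit_count_def sum_divide_distrib)
qed

theorem lemma1:
  fixes s :: nat and x :: real
  assumes "s \<ge> 2"
    and "x \<in> {0..1}"
    and "\<And>i. i < s \<Longrightarrow> convergent (rel_digit_count s i x)"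
  shows "convergent (digit_mean s x) \<and>
         asymp_digit_mean s x = (\<Sum>i=1..s-1. real i * digit_freq s i x)"
proof -
  have "rel_digit_count s i x \<longlonglongrightarrow> digit_freq s i x" if "i \<in> {1..s-1}" for i
    using assms(3)[of i] that unfolding digit_freq_def convergent_LIMSEQ_iff by auto
  then have "(\<lambda>n. \<Sum>i=1..s-1. real i * rel_digit_count s i x n)
      \<longlonglongrightarrow> (\<Sum>i=1..s-1. real i * digit_freq s i x)"
    by (intro tendsto_sum tendsto_mult tendsto_const)
  moreover have "digit_mean s x = (\<lambda>n. \<Sum>i=1..s-1. real i * rel_digit_count s i x n)"
    using digit_mean_eq_sum_rel_digit_count[of s x] assms(1,2) by fastforce
  ultimately have "digit_mean s x \<longlonglongrightarrow> (\<Sum>i=1..s-1. real i * digit_freq s i x)"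
    by simp
  then show ?thesis
    unfolding asymp_digit_mean_def by (auto simp: convergent_def limI)
qed

end
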